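(* For every real number $x$ and every integer $n\ge0$, $$V_n(x)=\sum_{k=0}^n\binom xk^2\binom{-1-x}{n-k}^2=\sum_{k=0}^n\binom nk\binom{n+k}k(-1)^{n-k}G_k(x).$$
   Context: For real $x$ and integer $k\ge0$, $\binom xk=x(x-1)\cdots(x-k+1)/k!$. $G_n(x)=\sum_{k=0}^n\binom nk(-1)^k\binom xk\binom{-1-x}k$ and $V_n(x)=\sum_{k=0}^n\binom nk\binom{n+k}k(-1)^k\binom xk\binom{-1-x}k$. *)

theory Defs
  imports Complex_Main
begin

definition G :: "nat \<Rightarrow> real \<Rightarrow> real" where
  "G n x = (\<Sum>k=0..n. real (n choose k) * (-1) ^ k * (x gchoose k) * ((-1 - x) gchoose k))"

definition V :: "nat \<Rightarrow> real \<Rightarrow> real" where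
  "V n x = (\<Sum>k=0..n. real (n choose k) * real ((n + k) choose k) * (-1) ^ k
              * (x gchoose k) * ((-1 - x) gchoose k))"

end

theory Submission
  imports Defs "HOL-Computational_Algebra.Formal_Power_Series"
begin

text \<open>
  With \<open>q y k = (-1)^k (y choose k) (-1-y choose k)\<close> one has \<open>V n x = (\<Sum>k. q n k * q x k)\<close>.
  Creative telescoping shows that \<open>V\<close> and the sum of products of squared binomials both satisfy
  the Apery-like recurrence
  \<open>(n+1)^3 u(n+1) = (2n+1)(n^2 + n + 1 + 2x(x+1)) u(n) - n^3 u(n-1)\<close>,
  and they agree for \<open>n = 0, 1\<close>. The expansion of \<open>V\<close> in terms of \<open>G\<close> follows by exchanging the
  order of summation and applying Vandermonde's convolution to the inner sum.
\<close>

section \<open>Ratios and shifts of the terms \<open>q y k\<close>\<close>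

definition q :: "real \<Rightarrow> nat \<Rightarrow> real" where
  "q y k = (-1) ^ k * (y gchoose k) * ((-1 - y) gchoose k)"

lemma gchoose_Suc: "((a::real) gchoose Suc k) = (a - real k) / (real k + 1) * (a gchoose k)"
  using gbinomial_mult_1[of a k] by (simp add: field_simps)

lemma q_0 [simp]: "q y 0 = 1"
  by (simp add: q_def)

lemma q_Suc: "q y (Suc k) = (y - real k) * (y + 1 + real k) / (real k + 1)\<^sup>2 * q y k"
  by (simp add: q_def gchoose_Suc power2_eq_square divide_simps) algebra

lemma q_reflect: "q (-1 - y) k = q y k"
  by (simp add: q_def)

text \<open>The direct quotient of \<open>q (y + 1) k\<close> by \<open>q y k\<close> is (y + 1 + k)
  / (y + 1 - k), with a pole at y = k - 1. Raising the index together with \<open>y\<close> leaves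
  only the denominator \<open>(real k + 1)\<^sup>2\<close>, so integer \<open>y\<close> needs no
  exception.\<close>

lemma q_plus1_Suc:
  "q (y + 1) (Suc k) = (y + real k + 2) * (y + real k + 1) / (real k + 1)\<^sup>2 * q y k"
proof (induction k)
  case 0
  show ?case by (simp add: q_Suc)
next
  case (Suc k)
  define d e where "d = (1 + real k + 1)\<^sup>2" and "e = (real k + 1)\<^sup>2"
  show ?case
    unfolding q_Suc[of "y + 1" "Suc k"] Suc.IH q_Suc[of y k] of_nat_Suc
      d_def[symmetric] e_def[symmetric] times_divide_eq_left times_divide_eq_right
    by (intro arg_cong[where f = "\<lambda>t. t / d / e"]) algebra
qed

lemma q_minus1_Suc:
  "q (y - 1) (Suc k) = (y - real k - 1) * (y - real k) / (real k + 1)\<^sup>2 * q y k"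
proof -
  \<comment> \<open>The reflection y -> -1 - y turns a downward shift into an upward one.\<close>
  have "q (y - 1) (Suc k) = q (-1 - y + 1) (Suc k)"
    using q_reflect[of "y - 1" "Suc k"] by simp
  also have "\<dots> = (y - real k - 1) * (y - real k) / (real k + 1)\<^sup>2 * q y k"
    unfolding q_plus1_Suc q_reflect by (simp add: algebra_simps)
  finally show ?thesis .
qed

lemma q_eq_0: "q (real n) k = 0" if "n < k"
  using that by (simp add: q_def flip: binomial_gbinomial)

lemma gchoose_neg_nat: "((-1 - real n) gchoose k) = (-1) ^ k * real ((n + k) choose k)"
  using gbinomial_minus[of "1 + real n" k] by (simp add: binomial_gbinomial algebra_simps)

lemma q_of_nat: "q (real n) k = real (n choose k) * real ((n + k) choose k)"
  by (simp add: q_def gchoose_neg_nat binomial_gbinomial flip: power_mult_distrib mult.assoc)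

text \<open>The free bound \<open>N\<close> lets three consecutive values of \<open>V\<close> be
  summed over one range.\<close>

lemma V_eq_sum_q: "V n x = (\<Sum>k<N. q (real n) k * q x k)" if "n < N"
proof -
  have "V n x = (\<Sum>k\<in>{0..n}. q (real n) k * q x k)"
    unfolding V_def q_of_nat by (simp add: q_def mult_ac)
  also have "\<dots> = (\<Sum>k<N. q (real n) k * q x k)"
    using that by (intro sum.mono_neutral_left) (auto simp: q_eq_0)
  finally show ?thesis .
qed

section \<open>Recurrence for \<open>V\<close>\<close>

text \<open>\<open>g\<close> is the creative-telescoping certificate. Its factor
  \<open>(real k)\<^sup>2\<close> makes \<open>g 0\<close> vanish, so the truncated
  \<open>k - 1\<close> is harmless there.\<close>

lemma q_telescope:
  fixes x y :: real
  defines "g \<equiv> \<lambda>k. 2 * (2 * y + 1) * (real k)\<^sup>2 * q y (k - 1) * q x k"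
  shows "(y + 1) ^ 3 * (q (y + 1) k * q x k)
      - (2 * y + 1) * (y\<^sup>2 + y + 1 + 2 * x * (x + 1)) * (q y k * q x k)
      + y ^ 3 * (q (y - 1) k * q x k) = g k - g (Suc k)"
proof (cases k)
  case 0
  show ?thesis unfolding g_def 0 by (simp add: q_Suc) algebra
next
  case (Suc j)
  \<comment> \<open>All four values of \<open>q\<close> at \<open>y\<close> and its neighbours are
    polynomial multiples of \<open>c\<close>, which reduces the claim to a polynomial
    identity.\<close>
  define c where "c = q y j / (real j + 1)\<^sup>2"
  define d where "d = q x k"
  have y: "q y k = (y - real j) * (y + 1 + real j) * c"
    "q (y + 1) k = (y + real j + 2) * (y + real j + 1) * c"
    "q (y - 1) k = (y - real j - 1) * (y - real j) * c"
    "q y j = (real j + 1)\<^sup>2 * c"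
    unfolding Suc c_def q_plus1_Suc q_minus1_Suc q_Suc[of y j] by simp_all
  have "(real k + 1)\<^sup>2 * q x (Suc k) = (x - real k) * (x + 1 + real k) * d"
    unfolding d_def by (simp add: q_Suc)
  then have g': "g (Suc k) = 2 * (2 * y + 1) * ((x - real k) * (x + 1 + real k) * d) * q y k"
    by (simp add: g_def add.commute)
  have g: "g k = 2 * (2 * y + 1) * (real j + 1)\<^sup>2 * ((real j + 1)\<^sup>2 * c) * d"
    unfolding y(4)[symmetric] by (simp add: g_def d_def Suc add.commute)
  show ?thesis
    unfolding g g' y d_def[symmetric] unfolding Suc of_nat_Suc by algebra
qed

definition sq_sum :: "nat \<Rightarrow> real \<Rightarrow> real" where
  "sq_sum n x = (\<Sum>k=0..n. (x gchoose k)\<^sup>2 * ((-1 - x) gchoose (n - k))\<^sup>2)"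

lemma V_rec:
  "(real n + 2) ^ 3 * V (Suc (Suc n)) x
    = (2 * real n + 3) * ((real n + 1)\<^sup>2 + real n + 2 + 2 * x * (x + 1)) * V (Suc n) x
      - (real n + 1) ^ 3 * V n x"
proof -
  define y where "y = real (Suc n)"
  define g where "g = (\<lambda>k. 2 * (2 * y + 1) * (real k)\<^sup>2 * q y (k - 1) * q x k)"
  let ?N = "n + 3"
  have shift: "real (Suc (Suc n)) = y + 1" "real n = y - 1"
    by (simp_all add: y_def)
  have V: "V (Suc (Suc n)) x = (\<Sum>k<?N. q (y + 1) k * q x k)"
    "V (Suc n) x = (\<Sum>k<?N. q y k * q x k)"
    "V n x = (\<Sum>k<?N. q (y - 1) k * q x k)"
    by (subst V_eq_sum_q[of _ ?N]; simp add: y_def add.commute)+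
  have "(y + 1) ^ 3 * V (Suc (Suc n)) x
      - (2 * y + 1) * (y\<^sup>2 + y + 1 + 2 * x * (x + 1)) * V (Suc n) x + y ^ 3 * V n x
      = (\<Sum>k<?N. g k - g (Suc k))"
    unfolding V sum_distrib_left sum_subtractf[symmetric] sum.distrib[symmetric] g_def
    by (intro sum.cong refl q_telescope)
  also have "\<dots> = g 0 - g ?N"
    by (rule sum_lessThan_telescope')
  also have "\<dots> = 0"
    \<comment> \<open>At the upper end \<open>g\<close> contains
      \<open>q (real (n + 1)) (n + 2)\<close>, which is zero.\<close>
    by (simp add: g_def y_def q_eq_0 del: of_nat_Suc)
  finally show ?thesis
    by (simp add: y_def algebra_simps)
qed

section \<open>Recurrence for the sum of squared binomials\<close>

text \<open>Extending by zero to negative indices keeps the ratio of consecutive terms valid for all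
  integers, so that the telescoping identity below has no boundary cases.\<close>

definition gchoose_sq :: "real \<Rightarrow> int \<Rightarrow> real" where
  "gchoose_sq a j = (if j < 0 then 0 else (a gchoose nat j)\<^sup>2)"

lemma gchoose_sq_rec:
  "(of_int j + 1)\<^sup>2 * gchoose_sq a (j + 1) = (a - of_int j)\<^sup>2 * gchoose_sq a j"
proof (cases "j < 0")
  case True
  \<comment> \<open>Only at \<open>j = -1\<close> is the left-hand term nonzero, and there the
    factor \<open>of_int j + 1\<close> vanishes.\<close>
  then show ?thesis by (cases "j = -1") (auto simp: gchoose_sq_def)
next
  case False
  then have "nat (j + 1) = Suc (nat j)" "real (nat j) = of_int j" "of_int j + 1 \<noteq> (0::real)"
    by auto
  with False show ?thesis
    by (simp add: gchoose_sq_def gchoose_Suc power_mult_distrib power_divide)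
qed

lemma sq_sum_eq_sum:
  "sq_sum n x = (\<Sum>k<N. (x gchoose k)\<^sup>2 * gchoose_sq (-1 - x) (int n - int k))" if "n < N"
proof -
  have "sq_sum n x = (\<Sum>k\<in>{0..n}. (x gchoose k)\<^sup>2 * gchoose_sq (-1 - x) (int n - int k))"
    unfolding sq_sum_def
    by (intro sum.cong refl) (auto simp: gchoose_sq_def nat_diff_distrib)
  also have "\<dots> = (\<Sum>k<N. (x gchoose k)\<^sup>2 * gchoose_sq (-1 - x) (int n - int k))"
    using that by (intro sum.mono_neutral_left) (auto simp: gchoose_sq_def)
  finally show ?thesis .
qed

text \<open>The factor \<open>(real k)\<^sup>2\<close> in the certificate \<open>g\<close> clears
  the denominator of \<open>U (Suc k)\<close>. What remains is linear in three neighbouring values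
  of \<open>W\<close>, and follows from their two ratio relations \<open>r1\<close> and
  \<open>r2\<close> without any division.\<close>

lemma sq_telescope:
  fixes x :: real and m :: int and k :: nat
  defines "y \<equiv> of_int m"
  defines "U \<equiv> \<lambda>k. (x gchoose k)\<^sup>2" and "W \<equiv> gchoose_sq (-1 - x)"
  defines "g \<equiv> \<lambda>k. (real k)\<^sup>2 * U k * ((2 * x + 3 * y - 2 * real k + 2) * W (m - int k)
                     - (3 * y + 3 - 2 * real k) * W (m + 1 - int k))"
  shows "(y + 1) ^ 3 * (U k * W (m + 1 - int k))
      - (2 * y + 1) * (y\<^sup>2 + y + 1 + 2 * x * (x + 1)) * (U k * W (m - int k))
      + y ^ 3 * (U k * W (m - 1 - int k)) = g (Suc k) - g k"
proof -
  define s where "s = real k"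
  define u where "u = U k"
  define w0 where "w0 = W (m + 1 - int k)"
  define w1 where "w1 = W (m - int k)"
  define w2 where "w2 = W (m - 1 - int k)"
  have r1: "(y + 1 - s)\<^sup>2 * w0 = (x + y + 1 - s)\<^sup>2 * w1"
    using gchoose_sq_rec[of "m - int k" "-1 - x"]
    by (simp add: W_def w0_def w1_def y_def s_def algebra_simps power2_eq_square)
  have r2: "(y - s)\<^sup>2 * w1 = (x + y - s)\<^sup>2 * w2"
    using gchoose_sq_rec[of "m - 1 - int k" "-1 - x"]
    by (simp add: W_def w1_def w2_def y_def s_def algebra_simps power2_eq_square)
  have "(s + 1)\<^sup>2 * U (Suc k) = (x - s)\<^sup>2 * u"
    by (simp add: U_def u_def s_def gchoose_Suc power_mult_distrib power_divide)
  moreover have "g (Suc k) = (s + 1)\<^sup>2 * U (Suc k) * ((2 * x + 3 * y - 2 * s) * w2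
                     - (3 * y + 1 - 2 * s) * w1)"
    by (simp add: g_def s_def w1_def w2_def algebra_simps)
  ultimately have g': "g (Suc k) = (x - s)\<^sup>2 * u * ((2 * x + 3 * y - 2 * s) * w2
                     - (3 * y + 1 - 2 * s) * w1)"
    by simp
  have g: "g k = s\<^sup>2 * u * ((2 * x + 3 * y - 2 * s + 2) * w1 - (3 * y + 3 - 2 * s) * w0)"
    by (simp add: g_def s_def u_def w0_def w1_def)
  show ?thesis
    unfolding g g' u_def[symmetric] w0_def[symmetric] w1_def[symmetric] w2_def[symmetric]
    using r1 r2 by algebra
qed

lemma sq_sum_rec:
  "(real n + 2) ^ 3 * sq_sum (Suc (Suc n)) x
    = (2 * real n + 3) * ((real n + 1)\<^sup>2 + real n + 2 + 2 * x * (x + 1)) * sq_sum (Suc n) x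
      - (real n + 1) ^ 3 * sq_sum n x"
proof -
  define m where "m = int n + 1"
  define y :: real where "y = of_int m"
  define U where "U = (\<lambda>k. (x gchoose k)\<^sup>2)"
  define W where "W = gchoose_sq (-1 - x)"
  define g where "g = (\<lambda>k. (real k)\<^sup>2 * U k * ((2 * x + 3 * y - 2 * real k + 2) * W (m - int k)
                     - (3 * y + 3 - 2 * real k) * W (m + 1 - int k)))"
  let ?N = "n + 3"
  have S: "sq_sum (Suc (Suc n)) x = (\<Sum>k<?N. U k * W (m + 1 - int k))"
    "sq_sum (Suc n) x = (\<Sum>k<?N. U k * W (m - int k))"
    "sq_sum n x = (\<Sum>k<?N. U k * W (m - 1 - int k))"
    by (subst sq_sum_eq_sum[of _ ?N]; simp add: m_def U_def W_def add.commute)+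
  have "(y + 1) ^ 3 * sq_sum (Suc (Suc n)) x
      - (2 * y + 1) * (y\<^sup>2 + y + 1 + 2 * x * (x + 1)) * sq_sum (Suc n) x + y ^ 3 * sq_sum n x
      = (\<Sum>k<?N. g (Suc k) - g k)"
    unfolding S sum_distrib_left sum_subtractf[symmetric] sum.distrib[symmetric]
      g_def U_def W_def y_def
    by (intro sum.cong refl sq_telescope)
  also have "\<dots> = g ?N - g 0"
    by (rule sum_lessThan_telescope)
  also have "\<dots> = 0"
    \<comment> \<open>At \<open>k = n + 3\<close> the arguments of \<open>W\<close> are -2 and -1,
      where \<open>gchoose_sq\<close> is zero.\<close>
    by (simp add: g_def m_def W_def gchoose_sq_def)
  finally show ?thesis
    by (simp add: y_def m_def algebra_simps)
qed

lemma V_eq_sq_sum: "V n x = sq_sum n x"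
proof (induction n rule: induct_nat_012)
  case 0
  show ?case by (simp add: V_def sq_sum_def)
next
  case 1
  show ?case by (simp add: V_def sq_sum_def power2_eq_square algebra_simps)
next
  case (ge2 n)
  have "(real n + 2) ^ 3 * V (Suc (Suc n)) x = (real n + 2) ^ 3 * sq_sum (Suc (Suc n)) x"
    unfolding V_rec sq_sum_rec ge2.IH ..
  then show ?case by (simp add: add_eq_0_iff)
qed

section \<open>Expansion of \<open>V\<close> in terms of \<open>G\<close>\<close>

text \<open>The sign and the second binomial combine into \<open>b gchoose k\<close> with
  \<open>b = -1 - real n\<close>. Trinomial revision extracts \<open>b gchoose j\<close>, and the
  rest is a Vandermonde sum with upper argument \<open>b - real j + real n\<close>, that is
  \<open>-1 - real j\<close>.\<close>

lemma alternating_binomial_sum: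
  assumes "j \<le> n"
  shows "(\<Sum>k=j..n. real (n choose k) * real ((n + k) choose k) * (-1) ^ (n - k) * real (k choose j))
    = q (real n) j"
proof -
  define b where "b = -1 - real n"
  have "(\<Sum>k=j..n. real (n choose k) * real ((n + k) choose k) * (-1) ^ (n - k) * real (k choose j))
      = (\<Sum>k=j..n. (-1) ^ n * (b gchoose j) * ((b - real j gchoose (k - j)) * (real n gchoose (n - k))))"
  proof (rule sum.cong[OF refl])
    fix k assume k: "k \<in> {j..n}"
    have "real ((n + k) choose k) * (-1) ^ (n - k) = (-1) ^ n * (b gchoose k)"
      using k by (simp add: b_def gchoose_neg_nat minus_one_power_iff)
    moreover have "(b gchoose k) * real (k choose j) = (b gchoose j) * (b - real j gchoose (k - j))"
      using k gbinomial_trinomial_revision[of j k b] by (simp add: binomial_gbinomial)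
    moreover have "real (n choose k) = (real n gchoose (n - k))"
      using k binomial_symmetric[of k n] by (simp add: binomial_gbinomial)
    moreover have "N * C * s * K = t * B * (R * N)"
      if "C * s = t * B'" "B' * K = B * R" for N C s K t B B' R :: real
      using that by algebra
    ultimately show "real (n choose k) * real ((n + k) choose k) * (-1) ^ (n - k) * real (k choose j)
      = (-1) ^ n * (b gchoose j) * ((b - real j gchoose (k - j)) * (real n gchoose (n - k)))"
      by metis
  qed
  also have "\<dots> = (-1) ^ n * (b gchoose j) *
      (\<Sum>k=j..n. (b - real j gchoose (k - j)) * (real n gchoose (n - k)))"
    by (simp add: sum_distrib_left)
  also have "(\<Sum>k=j..n. (b - real j gchoose (k - j)) * (real n gchoose (n - k)))
      = (\<Sum>i=0..n-j. (b - real j gchoose i) * (real n gchoose (n - j - i)))"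
    using assms by (intro sum.reindex_bij_witness[of _ "\<lambda>i. i + j" "\<lambda>k. k - j"]) auto
  also have "\<dots> = (b - real j + real n gchoose (n - j))"
    by (rule gbinomial_Vandermonde)
  also have "b - real j + real n = -1 - real j"
    by (simp add: b_def)
  also have "(-1 - real j gchoose (n - j)) = (-1) ^ (n - j) * real (n choose j)"
    using assms by (simp add: gchoose_neg_nat binomial_symmetric[of j n])
  also have "(-1) ^ n * (b gchoose j) * ((-1) ^ (n - j) * real (n choose j)) = q (real n) j"
    using assms by (auto simp: q_def b_def binomial_gbinomial minus_one_power_iff)
  finally show ?thesis .
qed

lemma V_eq_sum_G:
  "V n x = (\<Sum>k=0..n. real (n choose k) * real ((n + k) choose k) * (-1) ^ (n - k) * G k x)"
proof -
  define c where "c = (\<lambda>k. real (n choose k) * real ((n + k) choose k) * (-1) ^ (n - k))"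
  have "(\<Sum>k=0..n. c k * G k x) = (\<Sum>k=0..n. \<Sum>j=0..k. c k * real (k choose j) * q x j)"
    by (simp add: G_def q_def sum_distrib_left mult_ac)
  \<comment> \<open>Both double sums run over the triangle j \<le> k \<le> n.\<close>
  also have "\<dots> = (\<Sum>j=0..n. \<Sum>k=j..n. c k * real (k choose j) * q x j)"
    by (simp add: sum.Sigma)
      (intro sum.reindex_bij_witness[of _ "\<lambda>(j, k). (k, j)" "\<lambda>(k, j). (j, k)"]; auto)
  also have "\<dots> = (\<Sum>j=0..n. q (real n) j * q x j)"
    by (intro sum.cong refl)
      (simp add: c_def flip: sum_distrib_right alternating_binomial_sum)
  also have "\<dots> = V n x"
    by (simp add: V_eq_sum_q[of n "Suc n"] atLeast0AtMost lessThan_Suc_atMost)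
  finally show ?thesis by (simp add: c_def)
qed

theorem theorem4p1:
  fixes x :: real and n :: nat
  shows "V n x = (\<Sum>k=0..n. (x gchoose k)\<^sup>2 * ((-1 - x) gchoose (n - k))\<^sup>2)
    \<and> (\<Sum>k=0..n. (x gchoose k)\<^sup>2 * ((-1 - x) gchoose (n - k))\<^sup>2)
      = (\<Sum>k=0..n. real (n choose k) * real ((n + k) choose k) * (-1) ^ (n - k) * G k x)"
  using V_eq_sq_sum[of n x] V_eq_sum_G[of n x] by (simp add: sq_sum_def)

end
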